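(* Let $\alpha:\mathcal S\to\mathbb R$ be any continuous function, let $\alpha_0=\alpha\circ\sigma:\mathbb R\to\mathbb R$, and let $K_0$ be defined on the base leaf $\mathcal L_0=\sigma(\mathbb R)\subset\mathcal S$ by $K_0(\sigma(t))=\alpha_0^t$ for $t\in\mathbb R$. Then $K_0$ can be extended to a continuous and surjective homomorphism $K:\mathcal S\to\Omega(\alpha_0)$. Therefore $\Omega(\alpha_0)$ is a quotient group of $\mathcal S$.
   Context: Universal one-dimensional solenoid: $\mathcal S=\varprojlim_n \mathbb R/n\mathbb Z$ (index set $\mathbb Z_+$ ordered by divisibility, bonding maps the canonical projections), a compact connected abelian topological group. Let $\sigma:\mathbb R\to\mathcal S$, $\sigma(t)=(t\bmod n)_n$, be the injective dense one-parameter subgroup; its image $\mathcal L_0$ is the path-connected component of the identity element $0\in\mathcal S$ and is called the base leaf. Let $C(\mathbb R)$ be the set of continuous functions $\mathbb R\to\mathbb R$ with the compact-open topology. For $\varphi\in C(\mathbb R)$ and $t\in\mathbb R$ put $\varphi^t(x)=\varphi(x+t)$, and let $\Omega(\varphi)$ be the closure in $C(\mathbb R)$ of the orbit $\{\varphi^t:t\in\mathbb R\}$. The group operation on $\Omega(\alpha_0)$ is $\lim_n\alpha_0^{t_n}*\lim_n\alpha_0^{s_n}=\lim_n\alpha_0^{t_n+s_n}$, with neutral element $\alpha_0$. *)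

theory Defs
  imports "HOL-Analysis.Analysis" "HOL-Algebra.Product_Groups"
begin

text \<open>HOL-Algebra groups and abstract topologies are kept as two separate objects on the same
  carrier; a topological group is such a pair.\<close>

definition real_group :: "real monoid" where
  "real_group = \<lparr>carrier = UNIV, monoid.mult = (+), one = 0\<rparr>"

definition multiples :: "nat \<Rightarrow> real set" where
  "multiples n = range (\<lambda>k::int. real n * of_int k)"

definition quotient_group_topology ::
    "('a, 'b) monoid_scheme \<Rightarrow> 'a topology \<Rightarrow> 'a set \<Rightarrow> 'a set topology" where
  "quotient_group_topology G T H =
     topology (\<lambda>V. V \<subseteq> carrier (G Mod H) \<and> openin T {x \<in> topspace T. H #>\<^bsub>G\<^esub> x \<in> V})"

definition circle_group :: "nat \<Rightarrow> real set monoid" where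
  "circle_group n = real_group Mod multiples n"

definition circle_topology :: "nat \<Rightarrow> real set topology" where
  "circle_topology n = quotient_group_topology real_group euclideanreal (multiples n)"

text \<open>For \<open>m dvd n\<close> this is the canonical projection from the reals modulo \<open>n\<close> to the reals
  modulo \<open>m\<close>: the sum of the coset of \<open>t\<close> modulo \<open>n\<close> and the multiples of \<open>m\<close> is the coset
  of \<open>t\<close> modulo \<open>m\<close>.\<close>

definition bonding_map :: "nat \<Rightarrow> real set \<Rightarrow> real set" where
  "bonding_map m A = multiples m <#>\<^bsub>real_group\<^esub> A"

definition solenoid :: "(nat \<Rightarrow> real set) set" where
  "solenoid = {x \<in> (\<Pi>\<^sub>E n\<in>{0<..}. carrier (circle_group n)).
     \<forall>m n. 0 < m \<longrightarrow> 0 < n \<longrightarrow> m dvd n \<longrightarrow> bonding_map m (x n) = x m}"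

definition solenoid_group :: "(nat \<Rightarrow> real set) monoid" where
  "solenoid_group = (product_group {0<..} circle_group) \<lparr>carrier := solenoid\<rparr>"

definition solenoid_topology :: "(nat \<Rightarrow> real set) topology" where
  "solenoid_topology = subtopology (product_topology circle_topology {0<..}) solenoid"

definition leaf_param :: "real \<Rightarrow> nat \<Rightarrow> real set" where
  "leaf_param t = (\<lambda>n\<in>{0<..}. multiples n #>\<^bsub>real_group\<^esub> t)"

definition base_leaf :: "(nat \<Rightarrow> real set) set" where
  "base_leaf = range leaf_param"

definition compact_open :: "(real \<Rightarrow> real) topology" where
  "compact_open = topology_generated_by
     {{f. continuous_on UNIV f \<and> f ` C \<subseteq> U} | C U. compact C \<and> open U}"

definition translate :: "(real \<Rightarrow> real) \<Rightarrow> real \<Rightarrow> real \<Rightarrow> real" where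
  "translate \<phi> t = (\<lambda>x. \<phi> (x + t))"

definition Omega :: "(real \<Rightarrow> real) \<Rightarrow> (real \<Rightarrow> real) set" where
  "Omega \<phi> = compact_open closure_of (range (translate \<phi>))"

definition Omega_topology :: "(real \<Rightarrow> real) \<Rightarrow> (real \<Rightarrow> real) topology" where
  "Omega_topology \<phi> = subtopology compact_open (Omega \<phi>)"

text \<open>The limit of the translates by \<open>t\<^sub>n + s\<^sub>n\<close> has to be independent of the sequences representing
  \<open>f\<close> and \<open>g\<close>; this fails for general \<open>\<phi>\<close>, where the description below is then unspecified.\<close>

definition Omega_mult ::
    "(real \<Rightarrow> real) \<Rightarrow> (real \<Rightarrow> real) \<Rightarrow> (real \<Rightarrow> real) \<Rightarrow> (real \<Rightarrow> real)" where
  "Omega_mult \<phi> f g = (THE h. \<forall>t s.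
     limitin compact_open (\<lambda>n::nat. translate \<phi> (t n)) f sequentially \<longrightarrow>
     limitin compact_open (\<lambda>n::nat. translate \<phi> (s n)) g sequentially \<longrightarrow>
     limitin compact_open (\<lambda>n::nat. translate \<phi> (t n + s n)) h sequentially)"

definition Omega_group :: "(real \<Rightarrow> real) \<Rightarrow> (real \<Rightarrow> real) monoid" where
  "Omega_group \<phi> = \<lparr>carrier = Omega \<phi>, monoid.mult = Omega_mult \<phi>, one = \<phi>\<rparr>"


lemma openin_quotient_group_topology:
  "openin (quotient_group_topology G T H) V \<longleftrightarrow>
     V \<subseteq> carrier (G Mod H) \<and> openin T {x \<in> topspace T. H #>\<^bsub>G\<^esub> x \<in> V}"
proof -
  have "istopology (\<lambda>V. V \<subseteq> carrier (G Mod H) \<and> openin T {x \<in> topspace T. H #>\<^bsub>G\<^esub> x \<in> V})"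
    unfolding istopology_def
  proof (intro conjI allI impI)
    fix S S' assume "S \<subseteq> carrier (G Mod H) \<and> openin T {x \<in> topspace T. H #>\<^bsub>G\<^esub> x \<in> S}"
      and "S' \<subseteq> carrier (G Mod H) \<and> openin T {x \<in> topspace T. H #>\<^bsub>G\<^esub> x \<in> S'}"
    moreover have "{x \<in> topspace T. H #>\<^bsub>G\<^esub> x \<in> S \<inter> S'} =
        {x \<in> topspace T. H #>\<^bsub>G\<^esub> x \<in> S} \<inter> {x \<in> topspace T. H #>\<^bsub>G\<^esub> x \<in> S'}" by auto
    ultimately show "S \<inter> S' \<subseteq> carrier (G Mod H)"
      and "openin T {x \<in> topspace T. H #>\<^bsub>G\<^esub> x \<in> S \<inter> S'}" by auto
  next
    fix \<K> assume *: "\<forall>S\<in>\<K>. S \<subseteq> carrier (G Mod H) \<and> openin T {x \<in> topspace T. H #>\<^bsub>G\<^esub> x \<in> S}"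
    then show "\<Union>\<K> \<subseteq> carrier (G Mod H)" by blast
    have "{x \<in> topspace T. H #>\<^bsub>G\<^esub> x \<in> \<Union>\<K>} = (\<Union>S\<in>\<K>. {x \<in> topspace T. H #>\<^bsub>G\<^esub> x \<in> S})" by auto
    with * show "openin T {x \<in> topspace T. H #>\<^bsub>G\<^esub> x \<in> \<Union>\<K>}" by auto
  qed
  then show ?thesis by (simp add: quotient_group_topology_def topology_inverse')
qed

lemma topspace_compact_open: "topspace compact_open = {f. continuous_on UNIV f}"
proof -
  have "{f::real\<Rightarrow>real. continuous_on UNIV f} =
      {f. continuous_on UNIV f \<and> f ` {} \<subseteq> (UNIV::real set)}" by simp
  then have "{f::real\<Rightarrow>real. continuous_on UNIV f} \<in>
      {{f. continuous_on UNIV f \<and> f ` C \<subseteq> U} | C U. compact C \<and> open U}"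
    using compact_empty open_UNIV by blast
  then show ?thesis
    unfolding compact_open_def topology_generated_by_topspace by blast
qed

lemma coset_multiples: "multiples n #>\<^bsub>real_group\<^esub> t = range (\<lambda>k::int. real n * of_int k + t)"
  by (auto simp: r_coset_def multiples_def real_group_def)

lemma bonding_map_eq: "bonding_map m A = (\<Union>k::int. \<Union>a\<in>A. {real m * of_int k + a})"
  by (auto simp: bonding_map_def set_mult_def multiples_def real_group_def)

lemma bonding_map_coset:
  assumes "m dvd n"
  shows "bonding_map m (multiples n #>\<^bsub>real_group\<^esub> t) = multiples m #>\<^bsub>real_group\<^esub> t"
proof -
  obtain c where c: "n = m * c" using assms by blast
  show ?thesis
  proof (rule Set.set_eqI, rule iffI)
    fix x assume "x \<in> bonding_map m (multiples n #>\<^bsub>real_group\<^esub> t)"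
    then obtain k l :: int where "x = real m * of_int k + (real n * of_int l + t)"
      by (auto simp: bonding_map_eq coset_multiples)
    then have "x = real m * of_int (k + int c * l) + t" by (simp add: c algebra_simps)
    then show "x \<in> multiples m #>\<^bsub>real_group\<^esub> t" unfolding coset_multiples by blast
  next
    fix x assume "x \<in> multiples m #>\<^bsub>real_group\<^esub> t"
    then obtain k :: int where "x = real m * of_int k + t" by (auto simp: coset_multiples)
    then have x: "x = real m * of_int k + (real n * of_int 0 + t)" by simp
    show "x \<in> bonding_map m (multiples n #>\<^bsub>real_group\<^esub> t)"
      unfolding bonding_map_eq coset_multiples using x by blast
  qed
qed

lemma leaf_param_in_solenoid: "leaf_param t \<in> solenoid"
proof -
  have "multiples n #>\<^bsub>real_group\<^esub> t \<in> carrier (circle_group n)" for n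
    unfolding circle_group_def FactGroup_def RCOSETS_def by (auto simp: real_group_def)
  then show ?thesis by (auto simp: solenoid_def leaf_param_def bonding_map_coset)
qed

lemma inj_leaf_param: "inj leaf_param"
proof (rule injI)
  fix s t assume eq: "leaf_param s = leaf_param t"
  obtain n :: nat where n: "\<bar>s - t\<bar> < real n" using reals_Archimedean2 by blast
  then have n0: "0 < n" by (cases n) auto
  have "multiples n #>\<^bsub>real_group\<^esub> s = multiples n #>\<^bsub>real_group\<^esub> t"
    using fun_cong[OF eq, of n] n0 by (simp add: leaf_param_def)
  moreover have "s \<in> multiples n #>\<^bsub>real_group\<^esub> s"
    unfolding coset_multiples by (rule range_eqI[of _ _ 0]) simp
  ultimately obtain k :: int where k: "s = real n * of_int k + t"
    by (auto simp: coset_multiples)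
  then have "real n * \<bar>of_int k\<bar> < real n * 1" using n by (simp add: abs_mult)
  then have "\<bar>of_int k :: real\<bar> < 1" using n0 by (simp only: mult_less_cancel_left_pos of_nat_0_less_iff)
  then have "k = 0" by linarith
  then show "s = t" using k by simp
qed

end

theory Submission
  imports Defs
begin

text \<open>Write \<open>\<chi>\<^sub>n\<close> for the character of the solenoid that sends \<open>\<sigma>(t)\<close> to \<open>exp(2\<pi>it/n)\<close>. The characters
  \<open>\<chi>\<^sub>n\<close> separate points, so by compactness \<open>\<alpha>\<close> is uniformly continuous with respect to the
  translation-invariant pseudometrics \<open>\<bar>\<chi>\<^sub>n x - \<chi>\<^sub>n y\<bar>\<close>. The extension is
  \<open>K x = (\<lambda>t. \<alpha>(x + \<sigma>(t)))\<close>. Since every point of the solenoid agrees with a point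
  \<open>\<sigma>(t)\<close>, \<open>0 \<le> t \<le> k!\<close>, under \<open>\<chi>\<^sub>1, \<dots>, \<chi>\<^sub>k\<close>, convergence \<open>K x\<^sub>n \<rightarrow> K x\<close> in the compact-open
  topology forces \<open>\<alpha>(x\<^sub>n + z) \<rightarrow> \<alpha>(x + z)\<close> uniformly in \<open>z\<close>. Hence limits of translates add, and
  the product of \<open>K x\<close> and \<open>K y\<close> is \<open>K (x + y)\<close>. The image of \<open>K\<close> is compact and contains
  the orbit as a dense subset, so it is \<open>\<Omega>(\<alpha>\<^sub>0)\<close>.\<close>

section \<open>The solenoid group and its characters\<close>

abbreviation residue :: "nat \<Rightarrow> real \<Rightarrow> real set" where
  "residue n t \<equiv> multiples n #>\<^bsub>real_group\<^esub> t"

lemma comm_group_real_group: "comm_group real_group"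
proof (rule comm_groupI)
  show "\<exists>y\<in>carrier real_group. y \<otimes>\<^bsub>real_group\<^esub> x = \<one>\<^bsub>real_group\<^esub>" for x
    by (rule bexI[of _ "- x"]) (auto simp: real_group_def)
qed (auto simp: real_group_def)

lemma group_real_group: "Group.group real_group"
  using comm_group_real_group by (rule comm_group.axioms(2))

lemma subgroup_multiples: "subgroup (multiples n) real_group"
proof (rule group.subgroupI)
  show "Group.group real_group" by (rule group_real_group)
  have inv: "inv\<^bsub>real_group\<^esub> a = - a" for a
    by (rule group.inv_equality[OF group_real_group]) (auto simp: real_group_def)
  show "inv\<^bsub>real_group\<^esub> a \<in> multiples n" if "a \<in> multiples n" for a
  proof -
    obtain k :: int where "a = real n * of_int k" using \<open>a \<in> multiples n\<close> by (auto simp: multiples_def)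
    then have "- a = real n * of_int (- k)" by simp
    then show ?thesis unfolding inv multiples_def by blast
  qed
  show "a \<otimes>\<^bsub>real_group\<^esub> b \<in> multiples n" if "a \<in> multiples n" "b \<in> multiples n" for a b
  proof -
    obtain k l :: int where "a = real n * of_int k" "b = real n * of_int l"
      using \<open>a \<in> _\<close> \<open>b \<in> _\<close> by (auto simp: multiples_def)
    then have "a \<otimes>\<^bsub>real_group\<^esub> b = real n * of_int (k + l)"
      by (simp add: real_group_def algebra_simps)
    then show ?thesis unfolding multiples_def by blast
  qed
qed (auto simp: real_group_def multiples_def)

lemma comm_group_circle_group: "comm_group (circle_group n)"
  unfolding circle_group_def
  by (rule comm_group.abelian_FactGroup[OF comm_group_real_group subgroup_multiples])

lemma carrier_circle_group: "carrier (circle_group n) = range (residue n)"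
  unfolding circle_group_def carrier_FactGroup by (simp add: real_group_def)

lemma mult_residue: "residue n s \<otimes>\<^bsub>circle_group n\<^esub> residue n t = residue n (s + t)"
proof -
  have "multiples n \<lhd> real_group"
    by (rule comm_group.subgroup_imp_normal[OF comm_group_real_group subgroup_multiples])
  from normal.rcos_sum[OF this, of s t] show ?thesis
    by (simp add: circle_group_def) (simp add: real_group_def)
qed

lemma one_circle_group: "\<one>\<^bsub>circle_group n\<^esub> = residue n 0"
  unfolding coset_multiples by (simp add: circle_group_def multiples_def)

lemma group_circle_group: "Group.group (circle_group n)"
  using comm_group_circle_group by (rule comm_group.axioms(2))

lemma inv_residue: "inv\<^bsub>circle_group n\<^esub> residue n t = residue n (- t)"
  by (rule group.inv_equality[OF group_circle_group])
    (simp_all add: mult_residue one_circle_group carrier_circle_group)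

lemma solenoid_component: "x \<in> solenoid \<Longrightarrow> 0 < n \<Longrightarrow> x n \<in> range (residue n)"
  unfolding solenoid_def carrier_circle_group by (simp add: PiE_iff)

text \<open>Real representatives, compatible modulo every divisor, stand in for the cosets, so that
  closure properties reduce to arithmetic in the reals.\<close>

lemma solenoidI:
  assumes "x \<in> extensional {0<..}" "\<And>n. 0 < n \<Longrightarrow> x n = residue n (t n)"
    and "\<And>m n. \<lbrakk>0 < m; 0 < n; m dvd n\<rbrakk> \<Longrightarrow> residue m (t n) = residue m (t m)"
  shows "x \<in> solenoid"
  unfolding solenoid_def
proof (intro CollectI conjI allI impI)
  show "x \<in> (\<Pi>\<^sub>E n\<in>{0<..}. carrier (circle_group n))"
    using assms(1,2) by (simp add: PiE_iff carrier_circle_group)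
  show "bonding_map m (x n) = x m" if "0 < m" "0 < n" "m dvd n" for m n
    using assms(3)[OF that] that by (simp add: assms(2) bonding_map_coset)
qed

lemma solenoidE:
  assumes "x \<in> solenoid"
  obtains t where "\<And>n. 0 < n \<Longrightarrow> x n = residue n (t n)"
    and "\<And>m n. \<lbrakk>0 < m; 0 < n; m dvd n\<rbrakk> \<Longrightarrow> residue m (t n) = residue m (t m)"
proof -
  have "\<forall>n. \<exists>t. 0 < n \<longrightarrow> x n = residue n t"
    using solenoid_component[OF assms] by blast
  then obtain t where "\<forall>n. 0 < n \<longrightarrow> x n = residue n (t n)"
    by (rule choice[THEN exE])
  then have t: "\<And>n. 0 < n \<Longrightarrow> x n = residue n (t n)" by blast
  show thesis
  proof (rule that[OF t])
    fix m n :: nat assume mn: "0 < m" "0 < n" "m dvd n"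
    have "residue m (t n) = bonding_map m (x n)"
      using mn by (simp add: t bonding_map_coset)
    also have "\<dots> = x m" using assms mn unfolding solenoid_def by blast
    finally show "residue m (t n) = residue m (t m)" using mn by (simp add: t)
  qed
qed

lemma carrier_solenoid_group [simp]: "carrier solenoid_group = solenoid"
  by (simp add: solenoid_group_def)

lemma mult_solenoid_group:
  "x \<otimes>\<^bsub>solenoid_group\<^esub> y = (\<lambda>n\<in>{0<..}. x n \<otimes>\<^bsub>circle_group n\<^esub> y n)"
  by (simp add: solenoid_group_def)

lemma one_solenoid_group: "\<one>\<^bsub>solenoid_group\<^esub> = leaf_param 0"
  by (auto simp: solenoid_group_def leaf_param_def one_circle_group)

lemma leaf_param_add: "leaf_param (s + t) = leaf_param s \<otimes>\<^bsub>solenoid_group\<^esub> leaf_param t"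
  unfolding mult_solenoid_group leaf_param_def by (rule restrict_ext) (simp add: mult_residue)

lemma residue_add_cong:
  assumes "residue n s = residue n s'" "residue n t = residue n t'"
  shows "residue n (s + t) = residue n (s' + t')"
  using assms by (simp flip: mult_residue)

lemma residue_minus_cong: "residue n s = residue n s' \<Longrightarrow> residue n (- s) = residue n (- s')"
  by (simp flip: inv_residue)

text \<open>Compatibility under the bonding maps is a congruence condition on representatives, and
  congruences survive sums and negation.\<close>

lemma subgroup_solenoid: "subgroup solenoid (product_group {0<..} circle_group)"
proof (rule group.subgroupI)
  show "Group.group (product_group {0<..} circle_group)"
    by (simp add: group_circle_group)
  show "solenoid \<subseteq> carrier (product_group {0<..} circle_group)"
    by (auto simp: solenoid_def)
  show "solenoid \<noteq> {}" using leaf_param_in_solenoid by blast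
  show "inv\<^bsub>product_group {0<..} circle_group\<^esub> x \<in> solenoid" if x: "x \<in> solenoid" for x
  proof -
    obtain t where t: "\<And>n. 0 < n \<Longrightarrow> x n = residue n (t n)"
      "\<And>m n. \<lbrakk>0 < m; 0 < n; m dvd n\<rbrakk> \<Longrightarrow> residue m (t n) = residue m (t m)"
      using solenoidE[OF x] by blast
    have "inv\<^bsub>product_group {0<..} circle_group\<^esub> x = (\<lambda>n\<in>{0<..}. inv\<^bsub>circle_group n\<^esub> x n)"
      by (rule inv_product_group) (use x in \<open>auto simp: solenoid_def group_circle_group\<close>)
    then show ?thesis
      by (intro solenoidI[where t = "\<lambda>n. - t n"] residue_minus_cong t(2)) (simp_all add: t(1) inv_residue)
  qed
  show "x \<otimes>\<^bsub>product_group {0<..} circle_group\<^esub> y \<in> solenoid" if x: "x \<in> solenoid" and y: "y \<in> solenoid" for x y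
  proof -
    obtain s where s: "\<And>n. 0 < n \<Longrightarrow> x n = residue n (s n)"
      "\<And>m n. \<lbrakk>0 < m; 0 < n; m dvd n\<rbrakk> \<Longrightarrow> residue m (s n) = residue m (s m)"
      using solenoidE[OF x] by blast
    obtain t where t: "\<And>n. 0 < n \<Longrightarrow> y n = residue n (t n)"
      "\<And>m n. \<lbrakk>0 < m; 0 < n; m dvd n\<rbrakk> \<Longrightarrow> residue m (t n) = residue m (t m)"
      using solenoidE[OF y] by blast
    show ?thesis
    proof (rule solenoidI[where t = "\<lambda>n. s n + t n"])
      show "x \<otimes>\<^bsub>product_group {0<..} circle_group\<^esub> y \<in> extensional {0<..}"
        by simp
      show "(x \<otimes>\<^bsub>product_group {0<..} circle_group\<^esub> y) n = residue n (s n + t n)" if "0 < n" for n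
        using that by (simp add: s(1) t(1) mult_residue)
      show "residue m (s n + t n) = residue m (s m + t m)" if "0 < m" "0 < n" "m dvd n" for m n
        by (rule residue_add_cong[OF s(2) t(2)]) (rule that)+
    qed
  qed
qed

lemma comm_group_solenoid_group: "comm_group solenoid_group"
proof (rule group.group_comm_groupI)
  show "Group.group solenoid_group"
    unfolding solenoid_group_def
    by (rule subgroup.subgroup_is_group[OF subgroup_solenoid]) (simp add: group_circle_group)
  show "x \<otimes>\<^bsub>solenoid_group\<^esub> y = y \<otimes>\<^bsub>solenoid_group\<^esub> x"
    if "x \<in> carrier solenoid_group" "y \<in> carrier solenoid_group" for x y
    using that unfolding mult_solenoid_group
    by (rule_tac restrict_ext, rule_tac comm_monoid.m_comm[OF comm_group.axioms(1)[OF comm_group_circle_group]])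
      (simp_all add: solenoid_component carrier_circle_group)
qed

lemma solenoid_mult_closed: "x \<in> solenoid \<Longrightarrow> y \<in> solenoid \<Longrightarrow> x \<otimes>\<^bsub>solenoid_group\<^esub> y \<in> solenoid"
  using comm_monoid.axioms(1)[OF comm_group.axioms(1)[OF comm_group_solenoid_group], THEN monoid.m_closed, of x y]
  by simp

section \<open>Characters of the circles and of the solenoid\<close>

text \<open>The choice of representative is harmless: two of them differ by a multiple of
  \<open>n\<close>, which changes the angle by a multiple of 2 pi.\<close>

definition circle_char :: "nat \<Rightarrow> real set \<Rightarrow> complex" where
  "circle_char n A = cis (2 * pi * (SOME a. a \<in> A) / n)"

lemma circle_char_residue: "circle_char n (residue n t) = cis (2 * pi * t / n)"
proof -
  have "(SOME a. a \<in> residue n t) \<in> residue n t"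
    by (rule someI_ex) (auto simp: coset_multiples)
  then obtain k :: int where k: "(SOME a. a \<in> residue n t) = real n * of_int k + t"
    by (auto simp: coset_multiples)
  show ?thesis
  proof (cases "n = 0")
    \<comment> \<open>Division by zero yields 0, so both sides are \<open>cis 0\<close>.\<close>
    case True then show ?thesis by (simp add: circle_char_def)
  next
    case False
    then have "2 * pi * (real n * of_int k + t) / n = 2 * pi * of_int k + 2 * pi * t / n"
      by (simp add: field_simps)
    then show ?thesis
      by (simp add: circle_char_def k cis_mult[symmetric])
  qed
qed

text \<open>The kernel of \<open>t\<close> \<mapsto> \<open>cis (2 * pi * t / n)\<close> is exactly
  \<open>multiples n\<close>. Equality of cosets can thus be tested by complex numbers.\<close>

lemma circle_char_inj:
  assumes "0 < n" "circle_char n (residue n s) = circle_char n (residue n t)"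
  shows "residue n s = residue n t"
proof -
  have "cis (2 * pi * s / n - 2 * pi * t / n) = 1"
    using assms(2) by (simp add: circle_char_residue flip: cis_divide)
  then obtain k :: int where "2 * pi * s / n - 2 * pi * t / n = 2 * pi * of_int k"
    by (auto simp: complex_eq_iff cos_one_2pi_int)
  then have "2 * pi * s = 2 * pi * (n * of_int k + t)" using \<open>0 < n\<close> by (simp add: field_simps)
  then have "s = n * of_int k + t" by simp
  then have "s \<in> residue n t" by (auto simp: coset_multiples)
  then show ?thesis
    using group.repr_independence[OF group_real_group, of s "multiples n" t] subgroup_multiples
    by (simp add: real_group_def)
qed

definition solenoid_char :: "nat \<Rightarrow> (nat \<Rightarrow> real set) \<Rightarrow> complex" where
  "solenoid_char n x = circle_char n (x n)"

lemma solenoid_char_leaf_param: "0 < n \<Longrightarrow> solenoid_char n (leaf_param t) = cis (2 * pi * t / n)"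
  by (simp add: solenoid_char_def leaf_param_def circle_char_residue)

lemma solenoid_char_mult:
  assumes "0 < n" "x \<in> solenoid" "y \<in> solenoid"
  shows "solenoid_char n (x \<otimes>\<^bsub>solenoid_group\<^esub> y) = solenoid_char n x * solenoid_char n y"
proof -
  obtain s t where "x n = residue n s" "y n = residue n t"
    using solenoid_component[of x n] solenoid_component[of y n] assms by blast
  then show ?thesis
    using \<open>0 < n\<close>
    by (simp add: solenoid_char_def mult_solenoid_group mult_residue circle_char_residue cis_mult
        distrib_left add_divide_distrib)
qed

lemma norm_solenoid_char [simp]: "norm (solenoid_char n x) = 1"
  by (simp add: solenoid_char_def circle_char_def)

text \<open>Each character is injective on its circle and hence determines its component; at index 0
  both functions are undefined by extensionality.\<close>

lemma solenoid_eqI: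
  assumes "x \<in> solenoid" "y \<in> solenoid" "\<And>n. 0 < n \<Longrightarrow> solenoid_char n x = solenoid_char n y"
  shows "x = y"
proof (rule extensionalityI)
  show "x \<in> extensional {0<..}" "y \<in> extensional {0<..}"
    using assms by (auto simp: solenoid_def PiE_def)
  fix n :: nat assume "n \<in> {0<..}"
  then have "0 < n" by simp
  obtain s t where st: "x n = residue n s" "y n = residue n t"
    using solenoid_component[OF assms(1) \<open>0 < n\<close>] solenoid_component[OF assms(2) \<open>0 < n\<close>] by blast
  with assms(3)[OF \<open>0 < n\<close>] \<open>0 < n\<close> show "x n = y n"
    by (simp add: solenoid_char_def circle_char_inj[of n s t])
qed

section \<open>Quotient topologies on groups\<close>

lemma topspace_quotient_group_topology:
  assumes "Group.group G" "subgroup H G" "topspace T = carrier G"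
  shows "topspace (quotient_group_topology G T H) = carrier (G Mod H)"
proof
  show "topspace (quotient_group_topology G T H) \<subseteq> carrier (G Mod H)"
    unfolding topspace_def by (auto simp: openin_quotient_group_topology)
  have "{x \<in> topspace T. H #>\<^bsub>G\<^esub> x \<in> carrier (G Mod H)} = topspace T"
    using assms(3) by (auto simp: carrier_FactGroup)
  then have "openin (quotient_group_topology G T H) (carrier (G Mod H))"
    by (simp add: openin_quotient_group_topology)
  then show "carrier (G Mod H) \<subseteq> topspace (quotient_group_topology G T H)"
    by (rule openin_subset)
qed

lemma quotient_map_coset:
  assumes "Group.group G" "subgroup H G" "topspace T = carrier G"
  shows "quotient_map T (quotient_group_topology G T H) (\<lambda>x. H #>\<^bsub>G\<^esub> x)"
  unfolding quotient_map_def topspace_quotient_group_topology[OF assms]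
  by (auto simp: openin_quotient_group_topology carrier_FactGroup assms(3))

text \<open>A topological first isomorphism theorem. A continuous map from a compact space onto a
  Hausdorff space is a quotient map; the induced map on cosets inherits this and is injective, hence
  a homeomorphism.\<close>

lemma homeomorphic_map_coset_quotient:
  assumes "group_hom G H f" and T: "topspace T = carrier G" "compact_space T"
    and Y: "Hausdorff_space Y" "topspace Y = f ` carrier G" and f: "continuous_map T Y f"
  shows "homeomorphic_map (quotient_group_topology G T (kernel G H f)) Y (\<lambda>X. the_elem (f ` X))"
proof -
  interpret group_hom G H f by fact
  let ?N = "kernel G H f" and ?g = "\<lambda>X. the_elem (f ` X)"
  let ?Q = "quotient_group_topology G T ?N"
  have q: "quotient_map T ?Q (\<lambda>x. ?N #>\<^bsub>G\<^esub> x)"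
    by (rule quotient_map_coset[OF G.is_group subgroup_kernel T(1)])
  \<comment> \<open>The image of a kernel coset is a singleton, so \<open>the_elem\<close> returns
    the common value of \<open>f\<close> on it.\<close>
  have g: "?g (?N #>\<^bsub>G\<^esub> x) = f x" if "x \<in> carrier G" for x
  proof -
    have "f ` (?N #>\<^bsub>G\<^esub> x) = {f x}"
      using that G.one_closed by (force simp: r_coset_def kernel_def)
    then show ?thesis by simp
  qed
  have quot: "quotient_map T Y f"
    by (rule continuous_imp_quotient_map[OF f T(2) Y(1)]) (simp add: T(1) Y(2))
  have comp: "quotient_map T Y (?g \<circ> (\<lambda>x. ?N #>\<^bsub>G\<^esub> x))"
    using quot by (rule quotient_map_eq) (simp add: g T(1))
  have "continuous_map ?Q Y ?g"
    using continuous_compose_quotient_map[OF q quotient_imp_continuous_map[OF comp]] .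
  then have "quotient_map ?Q Y ?g"
    by (rule quotient_map_from_composition[OF quotient_imp_continuous_map[OF q] _ comp])
  moreover have "inj_on ?g (topspace ?Q)"
    unfolding topspace_quotient_group_topology[OF G.is_group subgroup_kernel T(1)]
    by (rule FactGroup_inj_on)
  ultimately show ?thesis
    unfolding homeomorphic_map_def by simp
qed

section \<open>Compactness of the solenoid\<close>

lemma topspace_circle_topology: "topspace (circle_topology n) = carrier (circle_group n)"
  unfolding circle_topology_def circle_group_def
  by (rule topspace_quotient_group_topology[OF group_real_group subgroup_multiples])
    (simp add: real_group_def)

lemma quotient_map_residue: "quotient_map euclideanreal (circle_topology n) (residue n)"
  unfolding circle_topology_def
  by (rule quotient_map_coset[OF group_real_group subgroup_multiples]) (simp add: real_group_def)

text \<open>Reduction modulo \<open>n\<close> by the fractional part of \<open>t / n\<close>; the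
  discarded integer part is invisible to the character, which is injective on cosets.\<close>

lemma residue_representative:
  assumes "0 < n"
  obtains u where "0 \<le> u" "u \<le> real n" "residue n t = residue n u"
proof -
  define u where "u = n * frac (t / n)"
  have "circle_char n (residue n t) = circle_char n (residue n u)"
  proof -
    have "2 * pi * t / n = 2 * pi * of_int \<lfloor>t / n\<rfloor> + 2 * pi * u / n"
      using assms by (simp add: u_def frac_def field_simps)
    then show ?thesis by (simp add: circle_char_residue flip: cis_mult)
  qed
  then have "residue n t = residue n u" by (rule circle_char_inj[OF assms])
  moreover have "0 \<le> u" "u \<le> n"
    using assms frac_ge_0[of "t / n"] frac_lt_1[of "t / n"]
    by (simp_all add: u_def mult_left_le less_imp_le)
  ultimately show thesis using that by blast
qed

text \<open>The compact interval from 0 to \<open>n\<close> already meets every coset, and the coset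
  map is continuous.\<close>

lemma compact_space_circle_topology:
  assumes "0 < n"
  shows "compact_space (circle_topology n)"
proof -
  have "compactin (circle_topology n) (residue n ` {0..real n})"
    by (rule image_compactin[of euclideanreal])
      (simp_all add: quotient_imp_continuous_map quotient_map_residue)
  moreover have "residue n ` {0..real n} = topspace (circle_topology n)"
    unfolding topspace_circle_topology carrier_circle_group
  proof (intro subset_antisym subsetI)
    fix A assume "A \<in> range (residue n)"
    then obtain t where "A = residue n t" by blast
    then show "A \<in> residue n ` {0..real n}"
      using residue_representative[OF assms, of t] by (metis atLeastAtMost_iff imageI)
  qed blast
  ultimately show ?thesis by (simp add: compact_space_def)
qed

lemma continuous_map_circle_char: "continuous_map (circle_topology n) euclidean (circle_char n)"
proof -
  have "continuous_map euclideanreal euclidean (circle_char n \<circ> residue n)"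
    by (cases "n = 0") (auto simp: o_def circle_char_residue cis_conv_exp intro!: continuous_intros)
  then show ?thesis
    using continuous_compose_quotient_map[OF quotient_map_residue] by blast
qed

lemma topspace_solenoid_topology [simp]: "topspace solenoid_topology = solenoid"
  by (auto simp: solenoid_topology_def topspace_circle_topology solenoid_def)

lemma continuous_map_solenoid_char:
  "0 < n \<Longrightarrow> continuous_map solenoid_topology euclidean (solenoid_char n)"
proof -
  assume "0 < n"
  then have "continuous_map (product_topology circle_topology {0<..}) euclidean (circle_char n \<circ> (\<lambda>x. x n))"
    by (intro continuous_map_compose[OF _ continuous_map_circle_char] continuous_map_product_projection) simp
  then show ?thesis
    unfolding solenoid_topology_def solenoid_char_def o_def by (rule continuous_map_from_subtopology)
qed

text \<open>In terms of characters the bonding map is the power map with exponent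
  \<open>n div m\<close>. Compatibility becomes an equation between continuous complex functions,
  hence a closed condition.\<close>

lemma bonding_map_eq_iff:
  assumes "0 < m" "0 < n" "m dvd n" "A \<in> carrier (circle_group n)" "B \<in> carrier (circle_group m)"
  shows "bonding_map m A = B \<longleftrightarrow> circle_char n A ^ (n div m) = circle_char m B"
proof -
  obtain s t where st: "A = residue n s" "B = residue m t"
    using assms(4,5) by (auto simp: carrier_circle_group)
  have "circle_char n A ^ (n div m) = circle_char m (residue m s)"
    using assms(1-3) by (auto simp: st circle_char_residue Complex.DeMoivre real_of_nat_div)
  moreover have "bonding_map m A = residue m s" by (simp add: st bonding_map_coset assms)
  ultimately show ?thesis using circle_char_inj[OF assms(1), of s t] by (auto simp: st)
qed

text \<open>By Tychonoff the product of circles is compact, and the solenoid is cut out of it by the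
  closed conditions \<open>?P m n\<close>.\<close>

lemma compact_space_solenoid_topology: "compact_space solenoid_topology"
proof -
  let ?X = "product_topology circle_topology {0<..}"
  let ?P = "\<lambda>m n. {x \<in> topspace ?X. circle_char n (x n) ^ (n div m) = circle_char m (x m)}"
  have X: "compact_space ?X"
    unfolding compact_space_product_topology using compact_space_circle_topology by blast
  have char: "continuous_map ?X euclidean (\<lambda>x. circle_char n (x n))" if "0 < n" for n
  proof -
    have "continuous_map ?X euclidean (circle_char n \<circ> (\<lambda>x. x n))"
      using that by (intro continuous_map_compose[OF _ continuous_map_circle_char] continuous_map_product_projection) simp
    then show ?thesis by (simp add: o_def)
  qed
  have closed: "closedin ?X (?P m n)" if "0 < m" "0 < n" for m n
  proof (rule closedin_continuous_maps_eq[of euclidean])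
    have "continuous_map euclidean euclidean (\<lambda>z::complex. z ^ (n div m))"
      by (simp add: continuous_intros)
    from continuous_map_compose[OF char[OF \<open>0 < n\<close>] this]
    show "continuous_map ?X euclidean (\<lambda>x. circle_char n (x n) ^ (n div m))" by (simp add: o_def)
  qed (simp_all add: char that)
  have X_eq: "topspace ?X = (\<Pi>\<^sub>E n\<in>{0<..}. carrier (circle_group n))"
    by (simp add: topspace_circle_topology)
  have "bonding_map m (x n) = x m \<longleftrightarrow> circle_char n (x n) ^ (n div m) = circle_char m (x m)"
    if "x \<in> topspace ?X" "0 < m" "0 < n" "m dvd n" for x m n
  proof (rule bonding_map_eq_iff[OF that(2-4)])
    show "x n \<in> carrier (circle_group n)" "x m \<in> carrier (circle_group m)"
      using that unfolding X_eq by (auto simp: PiE_iff)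
  qed
  then have "x \<in> topspace ?X \<and> (\<forall>m n. 0 < m \<longrightarrow> 0 < n \<longrightarrow> m dvd n \<longrightarrow> bonding_map m (x n) = x m) \<longleftrightarrow>
      x \<in> topspace ?X \<and> (\<forall>m n. 0 < m \<longrightarrow> 0 < n \<longrightarrow> m dvd n \<longrightarrow>
        circle_char n (x n) ^ (n div m) = circle_char m (x m))" for x
    by (intro conj_cong refl all_cong1 imp_cong)
  then have mem: "x \<in> solenoid \<longleftrightarrow> x \<in> topspace ?X \<and> (\<forall>m n. 0 < m \<longrightarrow> 0 < n \<longrightarrow> m dvd n \<longrightarrow>
      circle_char n (x n) ^ (n div m) = circle_char m (x m))" for x
    unfolding solenoid_def X_eq mem_Collect_eq .
  let ?R = "topspace ?X \<inter> (\<Inter>m\<in>{0<..}. \<Inter>n\<in>{n. 0 < n \<and> m dvd n}. ?P m n)"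
  have "solenoid = ?R"
  proof (rule Set.set_eqI)
    show "x \<in> solenoid \<longleftrightarrow> x \<in> ?R" for x
      unfolding mem Int_iff INT_iff mem_Collect_eq greaterThan_iff Ball_def by blast
  qed
  moreover have "closedin ?X ?R"
  proof (rule closedin_Int[OF closedin_topspace closedin_INT])
    fix m :: nat assume "m \<in> {0<..}"
    then show "closedin ?X (\<Inter>n\<in>{n. 0 < n \<and> m dvd n}. ?P m n)"
      by (intro closedin_INT closed) auto
  qed blast
  ultimately have "compactin ?X solenoid" using X closedin_compact_space by metis
  then show ?thesis unfolding solenoid_topology_def by (rule compact_space_subtopology)
qed

section \<open>The compact-open topology\<close>

lemma openin_compact_open_subbasic:
  assumes "compact C" "open U"
  shows "openin compact_open {f. continuous_on UNIV f \<and> f ` C \<subseteq> U}"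
  unfolding compact_open_def using assms by (intro topology_generated_by_Basis) blast

text \<open>Distinct functions differ at some point, and evaluation at that point separates them,
  singletons being compact.\<close>

lemma Hausdorff_space_compact_open: "Hausdorff_space compact_open"
  unfolding Hausdorff_space_def topspace_compact_open
proof (intro allI impI)
  fix f g :: "real \<Rightarrow> real"
  assume *: "f \<in> {f. continuous_on UNIV f} \<and> g \<in> {f. continuous_on UNIV f} \<and> f \<noteq> g"
  then obtain x where "f x \<noteq> g x" by blast
  then obtain U V where UV: "open U" "open V" "f x \<in> U" "g x \<in> V" "U \<inter> V = {}"
    using hausdorff[of "f x" "g x"] by auto
  have "disjnt {f. continuous_on UNIV f \<and> f ` {x} \<subseteq> U} {f. continuous_on UNIV f \<and> f ` {x} \<subseteq> V}"
    using UV by (auto simp: disjnt_iff)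
  then show "\<exists>U V. openin compact_open U \<and> openin compact_open V \<and> f \<in> U \<and> g \<in> V \<and> disjnt U V"
    using * UV openin_compact_open_subbasic[of "{x}" U] openin_compact_open_subbasic[of "{x}" V]
    by (intro exI conjI) (assumption | simp)+
qed

text \<open>The image of \<open>C\<close> under \<open>F x\<close> is compact, so a whole
  \<epsilon>-neighbourhood of it lies in \<open>U\<close>; uniform closeness on \<open>C\<close>
  then keeps \<open>F y\<close> in the subbasic set.\<close>

lemma continuous_map_compact_open:
  assumes "\<And>x. x \<in> topspace X \<Longrightarrow> continuous_on UNIV (F x)"
    and "\<And>x C \<epsilon>. \<lbrakk>x \<in> topspace X; compact C; 0 < \<epsilon>\<rbrakk> \<Longrightarrow>
      \<exists>V. openin X V \<and> x \<in> V \<and> (\<forall>y\<in>V. \<forall>t\<in>C. \<bar>F y t - F x t\<bar> < \<epsilon>)"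
  shows "continuous_map X compact_open F"
  unfolding compact_open_def
proof (rule continuous_on_generated_topo)
  fix W assume "W \<in> {{f :: real \<Rightarrow> real. continuous_on UNIV f \<and> f ` C \<subseteq> U} | C U. compact C \<and> open U}"
  then obtain C U where W: "W = {f. continuous_on UNIV f \<and> f ` C \<subseteq> U}" "compact C" "open U" by blast
  show "openin X (F -` W \<inter> topspace X)"
  proof (subst openin_subopen, intro ballI)
    fix x assume x: "x \<in> F -` W \<inter> topspace X"
    then have "compact (F x ` C)" "F x ` C \<subseteq> U"
      using W by (auto intro: compact_continuous_image continuous_on_subset)
    then obtain \<epsilon> where \<epsilon>: "0 < \<epsilon>" "(\<Union>a\<in>F x ` C. ball a \<epsilon>) \<subseteq> U"
      using compact_subset_open_imp_ball_epsilon_subset \<open>open U\<close> by metis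
    obtain V where V: "openin X V" "x \<in> V" "\<And>y t. y \<in> V \<Longrightarrow> t \<in> C \<Longrightarrow> \<bar>F y t - F x t\<bar> < \<epsilon>"
      using assms(2)[of x C \<epsilon>] x \<epsilon>(1) W(2) by blast
    have "F y t \<in> U" if "y \<in> V" "t \<in> C" for y t
    proof -
      have "F y t \<in> ball (F x t) \<epsilon>" using V(3)[OF that] by (simp add: dist_real_def abs_minus_commute)
      then show ?thesis using \<epsilon>(2) \<open>t \<in> C\<close> by blast
    qed
    moreover have "V \<subseteq> topspace X" using V(1) by (rule openin_subset)
    ultimately have "V \<subseteq> F -` W \<inter> topspace X"
      using assms(1) unfolding W(1) by blast
    then show "\<exists>T. openin X T \<and> x \<in> T \<and> T \<subseteq> F -` W \<inter> topspace X" using V by blast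
  qed
next
  have "F ` topspace X \<subseteq> topspace compact_open"
    unfolding topspace_compact_open using assms(1) by blast
  then show "F ` topspace X \<subseteq> \<Union> {{f :: real \<Rightarrow> real. continuous_on UNIV f \<and> f ` C \<subseteq> U} | C U. compact C \<and> open U}"
    by (simp add: compact_open_def)
qed

text \<open>Finitely many balls cover \<open>C\<close>, with \<open>f\<close> within \<epsilon>/2 of
  its central value on each closed ball. Each ball yields one subbasic neighbourhood of
  \<open>f\<close>, and finitely many such conditions eventually hold together.\<close>

lemma limitin_compact_open_imp_uniform:
  assumes lim: "limitin compact_open F f G" and "compact C" "0 < \<epsilon>"
  shows "\<forall>\<^sub>F n in G. \<forall>t\<in>C. \<bar>F n t - f t\<bar> < \<epsilon>"
proof -
  have f: "continuous_on UNIV f"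
    using limitin_topspace[OF lim] by (simp add: topspace_compact_open)
  have "\<exists>\<delta>>0. f ` cball c \<delta> \<subseteq> ball (f c) (\<epsilon> / 2)" for c
  proof -
    obtain \<delta> where "0 < \<delta>" and \<delta>: "\<And>t. dist t c < \<delta> \<Longrightarrow> dist (f t) (f c) < \<epsilon> / 2"
      using f \<open>0 < \<epsilon>\<close> unfolding continuous_on_iff by (metis UNIV_I half_gt_zero)
    then have "f ` cball c (\<delta> / 2) \<subseteq> ball (f c) (\<epsilon> / 2)"
      by (auto simp: dist_commute)
    then show ?thesis using \<open>0 < \<delta>\<close> half_gt_zero by blast
  qed
  then obtain \<delta> where \<delta>: "\<And>c. 0 < \<delta> c" "\<And>c. f ` cball c (\<delta> c) \<subseteq> ball (f c) (\<epsilon> / 2)"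
    by metis
  have "C \<subseteq> (\<Union>c\<in>C. ball c (\<delta> c))" using \<delta>(1) by force
  then obtain D where D: "D \<subseteq> C" "finite D" "C \<subseteq> (\<Union>c\<in>D. ball c (\<delta> c))"
    using compactE_image[OF \<open>compact C\<close>, of C "\<lambda>c. ball c (\<delta> c)"] by blast
  have "\<forall>\<^sub>F n in G. \<forall>c\<in>D. F n ` cball c (\<delta> c) \<subseteq> ball (f c) (\<epsilon> / 2)"
  proof (rule eventually_ball_finite[OF D(2)], rule ballI)
    fix c
    let ?W = "{g. continuous_on UNIV g \<and> g ` cball c (\<delta> c) \<subseteq> ball (f c) (\<epsilon> / 2)}"
    have "openin compact_open ?W"
      by (rule openin_compact_open_subbasic[OF compact_cball open_ball])
    moreover have "f \<in> ?W" using f \<delta>(2) by blast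
    ultimately have "\<forall>\<^sub>F n in G. F n \<in> ?W" using lim unfolding limitin_def by blast
    then show "\<forall>\<^sub>F n in G. F n ` cball c (\<delta> c) \<subseteq> ball (f c) (\<epsilon> / 2)"
      by (rule eventually_mono) blast
  qed
  then show ?thesis
  proof (rule eventually_mono, intro ballI)
    fix n t assume n: "\<forall>c\<in>D. F n ` cball c (\<delta> c) \<subseteq> ball (f c) (\<epsilon> / 2)" and "t \<in> C"
    then obtain c where "c \<in> D" and c: "t \<in> ball c (\<delta> c)" using D(3) by blast
    have "t \<in> cball c (\<delta> c)" using c ball_subset_cball by blast
    then have "F n t \<in> ball (f c) (\<epsilon> / 2)" "f t \<in> ball (f c) (\<epsilon> / 2)"
      using n \<open>c \<in> D\<close> \<delta>(2)[of c] by blast+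
    then show "\<bar>F n t - f t\<bar> < \<epsilon>" unfolding mem_ball dist_real_def by linarith
  qed
qed

text \<open>Induction over the generation of open sets from the subbasis. Only the subbasic case has
  content: there the compact image of \<open>C\<close> under \<open>f\<close> has a positive margin
  inside the open set.\<close>

lemma limitin_compact_open_uniformI:
  assumes "\<And>n. continuous_on UNIV (F n)" "continuous_on UNIV f"
    and unif: "\<And>\<epsilon>. 0 < \<epsilon> \<Longrightarrow> \<forall>\<^sub>F n in G. \<forall>t. \<bar>F n t - f t\<bar> < \<epsilon>"
  shows "limitin compact_open F f G"
  unfolding limitin_def
proof (intro conjI allI impI)
  show "f \<in> topspace compact_open" using assms(2) by (simp add: topspace_compact_open)
  fix U assume "openin compact_open U \<and> f \<in> U"
  then have "generate_topology_on {{f :: real \<Rightarrow> real. continuous_on UNIV f \<and> f ` C \<subseteq> U} | C U. compact C \<and> open U} U"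
    and "f \<in> U"
    by (auto simp: compact_open_def openin_topology_generated_by_iff)
  then show "\<forall>\<^sub>F n in G. F n \<in> U"
  proof induction
    case (Int a b) then show ?case by (simp add: eventually_conj)
  next
    case (UN \<K>)
    then obtain k where "k \<in> \<K>" "f \<in> k" by blast
    then have "\<forall>\<^sub>F n in G. F n \<in> k" using UN.IH by blast
    then show ?case by (rule eventually_mono) (use \<open>k \<in> \<K>\<close> in blast)
  next
    case (Basis s)
    then obtain C V where s: "s = {f. continuous_on UNIV f \<and> f ` C \<subseteq> V}" "compact C" "open V" by blast
    have "compact (f ` C)" "f ` C \<subseteq> V"
      using Basis s assms(2) by (auto intro: compact_continuous_image continuous_on_subset)
    then obtain \<epsilon> where \<epsilon>: "0 < \<epsilon>" "(\<Union>a\<in>f ` C. ball a \<epsilon>) \<subseteq> V"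
      using compact_subset_open_imp_ball_epsilon_subset \<open>open V\<close> by metis
    from unif[OF \<epsilon>(1)] show ?case
    proof (rule eventually_mono)
      fix n assume n: "\<forall>t. \<bar>F n t - f t\<bar> < \<epsilon>"
      have "F n t \<in> V" if "t \<in> C" for t
      proof -
        have "F n t \<in> ball (f t) \<epsilon>" using n by (simp add: dist_real_def abs_minus_commute)
        then show ?thesis using \<epsilon>(2) \<open>t \<in> C\<close> by blast
      qed
      then show "F n \<in> s" using assms(1) unfolding s(1) by blast
    qed
  qed simp
qed

section \<open>Uniform continuity\<close>

text \<open>One index bounds both the number of characters and the tolerance, so the relation
  shrinks as \<open>k\<close> grows. The inequality is non-strict, which makes the set of pairs that
  are not near open.\<close>

definition near :: "nat \<Rightarrow> (nat \<Rightarrow> real set) \<Rightarrow> (nat \<Rightarrow> real set) \<Rightarrow> bool" where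
  "near k x y \<longleftrightarrow> (\<forall>n\<in>{1..k}. dist (solenoid_char n x) (solenoid_char n y) \<le> 1 / k)"

text \<open>Characters are multiplicative of modulus 1, so the common factor \<open>z\<close> does
  not change the distance.\<close>

lemma near_mult:
  assumes "near k x y" "x \<in> solenoid" "y \<in> solenoid" "z \<in> solenoid"
  shows "near k (x \<otimes>\<^bsub>solenoid_group\<^esub> z) (y \<otimes>\<^bsub>solenoid_group\<^esub> z)"
  unfolding near_def
proof
  fix n assume n: "n \<in> {1..k}"
  then have "0 < n" by simp
  have "dist (solenoid_char n (x \<otimes>\<^bsub>solenoid_group\<^esub> z)) (solenoid_char n (y \<otimes>\<^bsub>solenoid_group\<^esub> z))
      = norm ((solenoid_char n x - solenoid_char n y) * solenoid_char n z)"
    unfolding dist_norm solenoid_char_mult[OF \<open>0 < n\<close> assms(2,4)] solenoid_char_mult[OF \<open>0 < n\<close> assms(3,4)]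
    by (simp only: left_diff_distrib)
  also have "\<dots> = dist (solenoid_char n x) (solenoid_char n y)"
    by (simp add: norm_mult dist_norm)
  also have "\<dots> \<le> 1 / k" using assms(1) n unfolding near_def by blast
  finally show "dist (solenoid_char n (x \<otimes>\<^bsub>solenoid_group\<^esub> z)) (solenoid_char n (y \<otimes>\<^bsub>solenoid_group\<^esub> z)) \<le> 1 / k" .
qed

lemma openin_near_neighbourhood:
  assumes "x \<in> solenoid" "0 < k"
  obtains V where "openin solenoid_topology V" "x \<in> V" "\<And>y. y \<in> V \<Longrightarrow> near k y x"
proof
  let ?W = "\<lambda>n. {y \<in> topspace solenoid_topology. solenoid_char n y \<in> ball (solenoid_char n x) (1 / k)}"
  let ?V = "topspace solenoid_topology \<inter> (\<Inter>n\<in>{1..k}. ?W n)"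
  have "openin solenoid_topology (?W n)" if "n \<in> {1..k}" for n
    using that by (intro openin_continuous_map_preimage[of _ euclidean] continuous_map_solenoid_char) simp_all
  then show "openin solenoid_topology ?V"
    using \<open>0 < k\<close> by (intro openin_Int openin_topspace openin_INT) auto
  show "x \<in> ?V" using assms by simp
  show "near k y x" if "y \<in> ?V" for y
    unfolding near_def
  proof
    fix n assume "n \<in> {1..k}"
    then have "solenoid_char n y \<in> ball (solenoid_char n x) (1 / k)"
      using \<open>y \<in> ?V\<close> by blast
    then show "dist (solenoid_char n y) (solenoid_char n x) \<le> 1 / k"
      by (simp add: dist_commute)
  qed
qed

text \<open>Every \<open>n\<close> up to \<open>k\<close> divides \<open>fact k\<close>, so the
  component at \<open>fact k\<close> determines all those components. A leaf point with the same
  residue there agrees with \<open>x\<close> in all of them; the range of \<open>t\<close> is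
  independent of \<open>x\<close>.\<close>

lemma solenoid_char_leaf_approx:
  assumes x: "x \<in> solenoid"
  obtains t where "0 \<le> t" "t \<le> fact k" "\<And>n. n \<in> {1..k} \<Longrightarrow> solenoid_char n (leaf_param t) = solenoid_char n x"
proof -
  have "0 < (fact k :: nat)" by simp
  then obtain s where s: "x (fact k) = residue (fact k) s"
    using solenoid_component[OF x] by blast
  obtain u where u: "0 \<le> u" "u \<le> real (fact k)" "residue (fact k) s = residue (fact k) u"
    using residue_representative[of "fact k" s] by auto
  have "leaf_param u n = x n" if "n \<in> {1..k}" for n
  proof -
    have n: "0 < n" "n dvd fact k" using that by (auto intro: dvd_fact)
    have "x n = bonding_map n (x (fact k))"
      using x n \<open>0 < (fact k :: nat)\<close> unfolding solenoid_def by blast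
    then show ?thesis using n by (simp add: s u(3) bonding_map_coset leaf_param_def)
  qed
  then show thesis
    using that[of u] u by (simp add: solenoid_char_def of_nat_fact)
qed

text \<open>Some character \<open>n\<close> separates the points. Taking \<open>k\<close> as a
  maximum makes it large enough both to include \<open>n\<close> and to push \<open>1 / k\<close>
  below the distance.\<close>

lemma dist_solenoid_char_cover:
  assumes "x \<in> solenoid" "y \<in> solenoid" "x \<noteq> y"
  obtains k :: nat and n where "0 < k" "n \<in> {1..k}" "1 / k < dist (solenoid_char n x) (solenoid_char n y)"
proof -
  obtain n where n: "0 < n" "solenoid_char n x \<noteq> solenoid_char n y"
    using solenoid_eqI[OF assms(1,2)] assms(3) by blast
  then obtain i where i: "inverse (real (Suc i)) < dist (solenoid_char n x) (solenoid_char n y)"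
    using reals_Archimedean[of "dist (solenoid_char n x) (solenoid_char n y)"] by auto
  have "1 / real (max n (Suc i)) \<le> 1 / real (Suc i)"
    by (intro divide_left_mono) auto
  then have "1 / real (max n (Suc i)) < dist (solenoid_char n x) (solenoid_char n y)"
    using i by (simp add: inverse_eq_divide)
  then show thesis using n(1) by (intro that[of "max n (Suc i)" n]) auto
qed

text \<open>The pairs on which \<alpha> differs by at least \<epsilon> form a compact set
  \<open>?A\<close> off the diagonal. The open sets \<open>?U k\<close> of pairs that are not near
  cover it, and the largest index of a finite subcover is the required \<open>k\<close>.\<close>

lemma solenoid_uniformly_continuous:
  assumes \<alpha>: "continuous_map solenoid_topology euclideanreal \<alpha>" and "0 < \<epsilon>"
  obtains k where "0 < k" "\<And>x y. \<lbrakk>x \<in> solenoid; y \<in> solenoid; near k x y\<rbrakk> \<Longrightarrow> \<bar>\<alpha> x - \<alpha> y\<bar> < \<epsilon>"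
proof -
  let ?X = "prod_topology solenoid_topology solenoid_topology"
  let ?A = "{p \<in> topspace ?X. \<bar>\<alpha> (fst p) - \<alpha> (snd p)\<bar> \<in> {\<epsilon>..}}"
  let ?d = "\<lambda>n p. norm (solenoid_char n (fst p) - solenoid_char n (snd p))"
  let ?U = "\<lambda>k::nat. \<Union>n\<in>{1..k}. {p \<in> topspace ?X. ?d n p \<in> {1 / k<..}}"
  have cont: "continuous_map ?X euclidean (\<lambda>p. f (fst p) - f (snd p))"
    if "continuous_map solenoid_topology euclidean f" for f :: "_ \<Rightarrow> 'b::real_normed_vector"
    using that by (intro continuous_map_diff continuous_map_compose[OF continuous_map_fst, unfolded o_def]
        continuous_map_compose[OF continuous_map_snd, unfolded o_def])
  have "continuous_map ?X euclidean (\<lambda>p. norm (\<alpha> (fst p) - \<alpha> (snd p)))"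
    by (rule continuous_map_norm[OF cont[OF \<alpha>]])
  then have closed: "closedin ?X ?A"
    by (intro closedin_continuous_map_preimage[of _ euclidean]) simp_all
  have "compact_space ?X"
    by (simp add: compact_space_prod_topology compact_space_solenoid_topology)
  then have A: "compactin ?X ?A" using closed by (rule closedin_compact_space)
  have U: "openin ?X (?U k)" for k
  proof (rule openin_Union, clarify)
    fix n assume "n \<in> {1..k}"
    then have "continuous_map ?X euclidean (?d n)"
      by (intro continuous_map_norm[OF cont] continuous_map_solenoid_char) simp
    then show "openin ?X {p \<in> topspace ?X. ?d n p \<in> {1 / k<..}}"
      by (rule openin_continuous_map_preimage) simp
  qed
  have cover: "?A \<subseteq> \<Union> (?U ` {0<..})"
  proof
    fix p assume p: "p \<in> ?A"
    then have "fst p \<in> solenoid" "snd p \<in> solenoid" by auto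
    moreover have "fst p \<noteq> snd p" using p \<open>0 < \<epsilon>\<close> by auto
    ultimately obtain k :: nat and n where "0 < k" "n \<in> {1..k}"
      "1 / k < dist (solenoid_char n (fst p)) (solenoid_char n (snd p))"
      using dist_solenoid_char_cover by metis
    then have "p \<in> ?U k" using p by (auto simp: dist_norm)
    then show "p \<in> \<Union> (?U ` {0<..})" using \<open>0 < k\<close> by blast
  qed
  have "\<exists>\<F>. finite \<F> \<and> \<F> \<subseteq> ?U ` {0<..} \<and> ?A \<subseteq> \<Union>\<F>"
    by (rule compactinD[OF A _ cover]) (use U in fast)
  then obtain \<F> where \<F>: "finite \<F>" "\<F> \<subseteq> ?U ` {0<..}" "?A \<subseteq> \<Union>\<F>" by (elim exE conjE)
  obtain D where D: "D \<subseteq> {0<..}" "finite D" "?A \<subseteq> \<Union> (?U ` D)"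
    using finite_subset_image[OF \<F>(1,2)] \<F>(3) by (elim exE conjE) (simp only:)
  \<comment> \<open>Inserting 1 keeps the maximum defined, and \<open>k\<close> positive, even when
    \<open>D\<close> is empty.\<close>
  define k where "k = Max (insert 1 D)"
  have k: "1 \<le> k" "\<And>j. j \<in> D \<Longrightarrow> j \<le> k"
    unfolding k_def using D(2) by (auto intro: Max_ge)
  show thesis
  proof (rule that)
    show "0 < k" using k by simp
    fix x y assume xy: "x \<in> solenoid" "y \<in> solenoid" "near k x y"
    show "\<bar>\<alpha> x - \<alpha> y\<bar> < \<epsilon>"
    proof (rule ccontr)
      assume "\<not> \<bar>\<alpha> x - \<alpha> y\<bar> < \<epsilon>"
      then have "(x, y) \<in> ?A" using xy by simp
      then have "(x, y) \<in> \<Union> (?U ` D)" using D(3) by blast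
      then obtain j where j: "j \<in> D" "(x, y) \<in> ?U j" by blast
      then obtain n where n: "n \<in> {1..j}" "1 / j < dist (solenoid_char n x) (solenoid_char n y)"
        by (auto simp: dist_norm)
      have "0 < j" "j \<le> k" using j(1) D(1) k(2) by auto
      then have "1 / real k \<le> 1 / real j" by (intro divide_left_mono) auto
      moreover have "dist (solenoid_char n x) (solenoid_char n y) \<le> 1 / k"
        using xy(3) n(1) \<open>j \<le> k\<close> unfolding near_def by auto
      ultimately show False using n(2) by linarith
    qed
  qed
qed

text \<open>A chord is at most as long as its arc: the chord equals twice the sine of half the
  angle.\<close>

lemma norm_cis_diff_le: "norm (cis a - cis b) \<le> \<bar>a - b\<bar>"
proof -
  have "cis a - cis b = cis b * (exp (\<i> * of_real (a - b)) - 1)"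
    unfolding cis_conv_exp[symmetric] by (simp add: right_diff_distrib cis_mult)
  then have "norm (cis a - cis b) = 2 * \<bar>sin ((a - b) / 2)\<bar>"
    by (simp only: norm_mult norm_cis dist_exp_i_1)
  also have "\<dots> \<le> 2 * \<bar>(a - b) / 2\<bar>" by (intro mult_left_mono abs_sin_x_le_abs_x) simp
  finally show ?thesis by simp
qed

section \<open>The hull of a function on the solenoid\<close>

definition hull_map :: "((nat \<Rightarrow> real set) \<Rightarrow> real) \<Rightarrow> (nat \<Rightarrow> real set) \<Rightarrow> real \<Rightarrow> real" where
  "hull_map \<alpha> x = (\<lambda>t. \<alpha> (x \<otimes>\<^bsub>solenoid_group\<^esub> leaf_param t))"

text \<open>Since \<sigma> is a homomorphism, the globally defined map restricts on the base leaf to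
  the prescribed translates.\<close>

lemma hull_map_leaf_param: "hull_map \<alpha> (leaf_param t) = translate (\<alpha> \<circ> leaf_param) t"
  by (simp add: hull_map_def translate_def fun_eq_iff add.commute flip: leaf_param_add)

locale solenoid_function =
  fixes \<alpha> :: "(nat \<Rightarrow> real set) \<Rightarrow> real"
  assumes continuous: "continuous_map solenoid_topology euclideanreal \<alpha>"
begin

sublocale solenoid: comm_group solenoid_group
  by (rule comm_group_solenoid_group)

abbreviation mult (infixl "\<cdot>" 70) where "x \<cdot> y \<equiv> x \<otimes>\<^bsub>solenoid_group\<^esub> y"

lemma mult_closed [simp]: "x \<in> solenoid \<Longrightarrow> y \<in> solenoid \<Longrightarrow> x \<cdot> y \<in> solenoid"
  by (rule solenoid_mult_closed)

text \<open>By translation invariance of \<open>near\<close>, the modulus of continuity of \<alpha>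
  serves all translates by \<open>z\<close> simultaneously.\<close>

lemma uniform_modulus:
  assumes "0 < \<epsilon>"
  obtains k where "0 < k"
    "\<And>x y z. \<lbrakk>x \<in> solenoid; y \<in> solenoid; near k x y; z \<in> solenoid\<rbrakk> \<Longrightarrow> \<bar>\<alpha> (x \<cdot> z) - \<alpha> (y \<cdot> z)\<bar> < \<epsilon>"
proof -
  obtain k where k: "0 < k" "\<And>x y. \<lbrakk>x \<in> solenoid; y \<in> solenoid; near k x y\<rbrakk> \<Longrightarrow> \<bar>\<alpha> x - \<alpha> y\<bar> < \<epsilon>"
    by (rule solenoid_uniformly_continuous[OF continuous assms]) (rule that)
  show thesis
    by (rule that[OF k(1)]) (intro k(2) near_mult mult_closed)
qed

text \<open>Along the leaf the character with index \<open>n\<close> is Lipschitz with constant 2 pi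
  / \<open>n\<close>, at most 2 pi; this dictates the value of \<open>?\<delta>\<close>.\<close>

lemma near_leaf_param:
  assumes "0 < k"
  obtains \<delta> where "0 < \<delta>" "\<And>s t. \<bar>s - t\<bar> < \<delta> \<Longrightarrow> near k (leaf_param s) (leaf_param t)"
proof -
  let ?\<delta> = "1 / (2 * pi * k)"
  have "near k (leaf_param s) (leaf_param t)" if st: "\<bar>s - t\<bar> < ?\<delta>" for s t
    unfolding near_def
  proof
    fix n assume "n \<in> {1..k}"
    then have n: "1 \<le> n" by simp
    have "norm (cis (2 * pi * s / n) - cis (2 * pi * t / n)) \<le> \<bar>2 * pi * s / n - 2 * pi * t / n\<bar>"
      by (rule norm_cis_diff_le)
    also have "\<dots> = 2 * pi * \<bar>s - t\<bar> / n"
      by (simp add: abs_mult flip: diff_divide_distrib right_diff_distrib)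
    also have "\<dots> \<le> 2 * pi * \<bar>s - t\<bar> / 1" using n by (intro divide_left_mono) auto
    also have "\<dots> \<le> 1 / k" using st assms by (simp add: field_simps)
    finally show "dist (solenoid_char n (leaf_param s)) (solenoid_char n (leaf_param t)) \<le> 1 / k"
      using n by (simp add: solenoid_char_leaf_param dist_norm)
  qed
  moreover have "0 < ?\<delta>" using assms by simp
  ultimately show thesis by (rule that[rotated])
qed

lemma continuous_hull_map:
  assumes x: "x \<in> solenoid"
  shows "continuous_on UNIV (hull_map \<alpha> x)"
  unfolding continuous_on_iff
proof (intro ballI allI impI)
  fix t \<epsilon> :: real assume "0 < \<epsilon>"
  then obtain k where k: "0 < k"
    "\<And>x y z. \<lbrakk>x \<in> solenoid; y \<in> solenoid; near k x y; z \<in> solenoid\<rbrakk> \<Longrightarrow> \<bar>\<alpha> (x \<cdot> z) - \<alpha> (y \<cdot> z)\<bar> < \<epsilon>"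
    by (rule uniform_modulus) (rule that)
  obtain \<delta> where \<delta>: "0 < \<delta>" "\<And>s t. \<bar>s - t\<bar> < \<delta> \<Longrightarrow> near k (leaf_param s) (leaf_param t)"
    by (rule near_leaf_param[OF k(1)]) (rule that)
  have "dist (hull_map \<alpha> x s) (hull_map \<alpha> x t) < \<epsilon>" if "dist s t < \<delta>" for s
  proof -
    \<comment> \<open>With the factors commuted, \<open>x\<close> is the translating element and the
      modulus applies to the two leaf points.\<close>
    have "\<bar>\<alpha> (leaf_param s \<cdot> x) - \<alpha> (leaf_param t \<cdot> x)\<bar> < \<epsilon>"
      using that by (intro k(2) \<delta>(2) leaf_param_in_solenoid x) (simp add: dist_real_def)
    moreover have "leaf_param u \<cdot> x = x \<cdot> leaf_param u" for u
      by (rule solenoid.m_comm) (simp_all add: leaf_param_in_solenoid x)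
    ultimately show ?thesis by (simp add: hull_map_def dist_real_def)
  qed
  then show "\<exists>\<delta>>0. \<forall>s\<in>UNIV. dist s t < \<delta> \<longrightarrow> dist (hull_map \<alpha> x s) (hull_map \<alpha> x t) < \<epsilon>"
    using \<delta>(1) by blast
qed

text \<open>The modulus is uniform over all leaf translates, so one neighbourhood of
  \<open>x\<close> gives the estimate on the whole line.\<close>

lemma continuous_map_hull_map: "continuous_map solenoid_topology compact_open (hull_map \<alpha>)"
proof (rule continuous_map_compact_open)
  fix x assume "x \<in> topspace solenoid_topology"
  then have x: "x \<in> solenoid" by simp
  then show "continuous_on UNIV (hull_map \<alpha> x)" by (rule continuous_hull_map)
  fix C :: "real set" and \<epsilon> :: real assume "0 < \<epsilon>"
  then obtain k where k: "0 < k"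
    "\<And>x y z. \<lbrakk>x \<in> solenoid; y \<in> solenoid; near k x y; z \<in> solenoid\<rbrakk> \<Longrightarrow> \<bar>\<alpha> (x \<cdot> z) - \<alpha> (y \<cdot> z)\<bar> < \<epsilon>"
    by (rule uniform_modulus) (rule that)
  obtain V where V: "openin solenoid_topology V" "x \<in> V" "\<And>y. y \<in> V \<Longrightarrow> near k y x"
    by (rule openin_near_neighbourhood[OF x k(1)]) (rule that)
  have "V \<subseteq> solenoid" using openin_subset[OF V(1)] by simp
  then have "\<forall>y\<in>V. \<forall>t\<in>C. \<bar>hull_map \<alpha> y t - hull_map \<alpha> x t\<bar> < \<epsilon>"
    unfolding hull_map_def by (intro ballI k(2) V(3) x leaf_param_in_solenoid) auto
  then show "\<exists>V. openin solenoid_topology V \<and> x \<in> V \<and> (\<forall>y\<in>V. \<forall>t\<in>C. \<bar>hull_map \<alpha> y t - hull_map \<alpha> x t\<bar> < \<epsilon>)"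
    using V by blast
qed

section \<open>Convergence in the hull as uniform convergence over the solenoid\<close>

lemma limitin_hull_mapI:
  assumes "\<And>n. x n \<in> solenoid" "l \<in> solenoid"
    and "\<And>\<epsilon>. 0 < \<epsilon> \<Longrightarrow> \<forall>\<^sub>F n in F. \<forall>z\<in>solenoid. \<bar>\<alpha> (x n \<cdot> z) - \<alpha> (l \<cdot> z)\<bar> < \<epsilon>"
  shows "limitin compact_open (\<lambda>n. hull_map \<alpha> (x n)) (hull_map \<alpha> l) F"
proof (rule limitin_compact_open_uniformI)
  fix \<epsilon> :: real assume "0 < \<epsilon>"
  from assms(3)[OF this] show "\<forall>\<^sub>F n in F. \<forall>t. \<bar>hull_map \<alpha> (x n) t - hull_map \<alpha> l t\<bar> < \<epsilon>"
    by (rule eventually_mono) (simp add: hull_map_def leaf_param_in_solenoid)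
qed (intro continuous_hull_map assms)+

text \<open>Up to an arbitrarily small error, \<open>\<alpha>\<close> factors through a single circle, and there a bounded
  segment of the leaf already meets every residue class.\<close>

lemma limitin_hull_map_imp_uniform:
  assumes x: "\<And>n. x n \<in> solenoid" and l: "l \<in> solenoid"
    and lim: "limitin compact_open (\<lambda>n. hull_map \<alpha> (x n)) (hull_map \<alpha> l) F" and "0 < \<epsilon>"
  shows "\<forall>\<^sub>F n in F. \<forall>z\<in>solenoid. \<bar>\<alpha> (x n \<cdot> z) - \<alpha> (l \<cdot> z)\<bar> < \<epsilon>"
proof -
  have "0 < \<epsilon> / 3" using \<open>0 < \<epsilon>\<close> by simp
  then obtain k where k: "0 < k"
    "\<And>x y z. \<lbrakk>x \<in> solenoid; y \<in> solenoid; near k x y; z \<in> solenoid\<rbrakk> \<Longrightarrow> \<bar>\<alpha> (x \<cdot> z) - \<alpha> (y \<cdot> z)\<bar> < \<epsilon> / 3"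
    by (rule uniform_modulus) (rule that)
  \<comment> \<open>This interval contains, for every \<open>z\<close>, the parameter of a leaf
    point sharing the first \<open>k\<close> characters of \<open>z\<close>.\<close>
  have "\<forall>\<^sub>F n in F. \<forall>t\<in>{0..fact k}. \<bar>hull_map \<alpha> (x n) t - hull_map \<alpha> l t\<bar> < \<epsilon> / 3"
    by (rule limitin_compact_open_imp_uniform[OF lim compact_Icc \<open>0 < \<epsilon> / 3\<close>])
  then show ?thesis
  proof (rule eventually_mono, intro ballI)
    fix n z assume n: "\<forall>t\<in>{0..fact k}. \<bar>hull_map \<alpha> (x n) t - hull_map \<alpha> l t\<bar> < \<epsilon> / 3"
      and z: "z \<in> solenoid"
    obtain t where t: "0 \<le> t" "t \<le> fact k" "\<And>n. n \<in> {1..k} \<Longrightarrow> solenoid_char n (leaf_param t) = solenoid_char n z"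
      by (rule solenoid_char_leaf_approx[OF z, of k]) (rule that)
    \<comment> \<open>The first \<open>k\<close> characters agree exactly, so the distances are 0.
      Replacing \<open>z\<close> by the leaf point costs \<epsilon>/3 on either side of the estimate
      on the interval.\<close>
    have "near k (leaf_param t) z" unfolding near_def using t(3) by simp
    then have near: "\<bar>\<alpha> (y \<cdot> leaf_param t) - \<alpha> (y \<cdot> z)\<bar> < \<epsilon> / 3" if "y \<in> solenoid" for y
      using k(2)[OF leaf_param_in_solenoid z _ that, of t]
        solenoid.m_comm[of y z] solenoid.m_comm[of y "leaf_param t"] z that leaf_param_in_solenoid
      by simp
    have "\<bar>\<alpha> (x n \<cdot> leaf_param t) - \<alpha> (l \<cdot> leaf_param t)\<bar> < \<epsilon> / 3"
      using n t(1,2) unfolding hull_map_def by simp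
    then show "\<bar>\<alpha> (x n \<cdot> z) - \<alpha> (l \<cdot> z)\<bar> < \<epsilon>"
      using near[OF x, of n] near[OF l] by linarith
  qed
qed

text \<open>The uniformity in \<open>z\<close> is decisive: the moving factor \<open>y n\<close> is
  absorbed into \<open>z\<close> when \<open>x n\<close> is replaced by \<open>a\<close>, and then
  \<open>a\<close> is absorbed when \<open>y n\<close> is replaced by \<open>b\<close>.\<close>

lemma limitin_hull_map_mult:
  assumes x: "\<And>n. x n \<in> solenoid" and y: "\<And>n. y n \<in> solenoid" and a: "a \<in> solenoid" and b: "b \<in> solenoid"
    and lim: "limitin compact_open (\<lambda>n. hull_map \<alpha> (x n)) (hull_map \<alpha> a) F"
      "limitin compact_open (\<lambda>n. hull_map \<alpha> (y n)) (hull_map \<alpha> b) F"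
  shows "limitin compact_open (\<lambda>n. hull_map \<alpha> (x n \<cdot> y n)) (hull_map \<alpha> (a \<cdot> b)) F"
proof (rule limitin_hull_mapI)
  fix \<epsilon> :: real assume "0 < \<epsilon>"
  then have "0 < \<epsilon> / 2" by simp
  from limitin_hull_map_imp_uniform[OF x a lim(1) this] limitin_hull_map_imp_uniform[OF y b lim(2) this]
  show "\<forall>\<^sub>F n in F. \<forall>z\<in>solenoid. \<bar>\<alpha> (x n \<cdot> y n \<cdot> z) - \<alpha> (a \<cdot> b \<cdot> z)\<bar> < \<epsilon>"
  proof (rule eventually_elim2, intro ballI)
    fix n z assume X: "\<forall>z\<in>solenoid. \<bar>\<alpha> (x n \<cdot> z) - \<alpha> (a \<cdot> z)\<bar> < \<epsilon> / 2"
      and Y: "\<forall>z\<in>solenoid. \<bar>\<alpha> (y n \<cdot> z) - \<alpha> (b \<cdot> z)\<bar> < \<epsilon> / 2" and z: "z \<in> solenoid"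
    have eqs: "x n \<cdot> y n \<cdot> z = x n \<cdot> (y n \<cdot> z)" "y n \<cdot> (a \<cdot> z) = a \<cdot> (y n \<cdot> z)"
      "b \<cdot> (a \<cdot> z) = a \<cdot> b \<cdot> z"
      using x y z a b by (simp_all add: solenoid.m_ac)
    have "\<bar>\<alpha> (x n \<cdot> (y n \<cdot> z)) - \<alpha> (a \<cdot> (y n \<cdot> z))\<bar> < \<epsilon> / 2"
      using X y z by (meson mult_closed)
    moreover have "\<bar>\<alpha> (a \<cdot> (y n \<cdot> z)) - \<alpha> (a \<cdot> b \<cdot> z)\<bar> < \<epsilon> / 2"
      unfolding eqs(2,3)[symmetric] using Y a z by (meson mult_closed)
    ultimately show "\<bar>\<alpha> (x n \<cdot> y n \<cdot> z) - \<alpha> (a \<cdot> b \<cdot> z)\<bar> < \<epsilon>"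
      unfolding eqs(1) by linarith
  qed
qed (intro mult_closed x y a b)+

text \<open>Choose \<open>t k\<close> so that its leaf point matches the first \<open>k\<close>
  characters of \<open>x\<close>. From any index on, all later leaf points are near
  \<open>x\<close>, and the modulus gives uniform convergence.\<close>

lemma hull_map_limit_of_translates:
  assumes x: "x \<in> solenoid"
  obtains t :: "nat \<Rightarrow> real" where
    "limitin compact_open (\<lambda>n. translate (\<alpha> \<circ> leaf_param) (t n)) (hull_map \<alpha> x) sequentially"
proof -
  have "\<exists>t. \<forall>n\<in>{1..k}. solenoid_char n (leaf_param t) = solenoid_char n x" for k
    using solenoid_char_leaf_approx[OF x, of k] by metis
  then obtain t where t: "\<And>k n. n \<in> {1..k} \<Longrightarrow> solenoid_char n (leaf_param (t k)) = solenoid_char n x"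
    by metis
  have "limitin compact_open (\<lambda>n. hull_map \<alpha> (leaf_param (t n))) (hull_map \<alpha> x) sequentially"
  proof (rule limitin_hull_mapI[OF leaf_param_in_solenoid x])
    fix \<epsilon> :: real assume "0 < \<epsilon>"
    then obtain k where k: "0 < k"
      "\<And>x y z. \<lbrakk>x \<in> solenoid; y \<in> solenoid; near k x y; z \<in> solenoid\<rbrakk> \<Longrightarrow> \<bar>\<alpha> (x \<cdot> z) - \<alpha> (y \<cdot> z)\<bar> < \<epsilon>"
      by (rule uniform_modulus) (rule that)
    have "near k (leaf_param (t m)) x" if "k \<le> m" for m
      unfolding near_def using t[of _ m] that by simp
    then have "\<forall>m\<ge>k. \<forall>z\<in>solenoid. \<bar>\<alpha> (leaf_param (t m) \<cdot> z) - \<alpha> (x \<cdot> z)\<bar> < \<epsilon>"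
      by (intro allI impI ballI k(2) leaf_param_in_solenoid x)
    then show "\<forall>\<^sub>F m in sequentially. \<forall>z\<in>solenoid. \<bar>\<alpha> (leaf_param (t m) \<cdot> z) - \<alpha> (x \<cdot> z)\<bar> < \<epsilon>"
      unfolding eventually_sequentially by blast
  qed
  then show thesis using that unfolding hull_map_leaf_param by blast
qed

text \<open>The compact image is closed in a Hausdorff space, so it contains the orbit closure;
  conversely each of its members is a limit of translates.\<close>

lemma Omega_eq_hull: "Omega (\<alpha> \<circ> leaf_param) = hull_map \<alpha> ` solenoid"
proof
  have "compactin compact_open (hull_map \<alpha> ` solenoid)"
    using image_compactin[OF _ continuous_map_hull_map, of solenoid] compact_space_solenoid_topology
    by (simp add: compact_space_def)
  then have "closedin compact_open (hull_map \<alpha> ` solenoid)"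
    by (rule compactin_imp_closedin[OF Hausdorff_space_compact_open])
  moreover have "range (translate (\<alpha> \<circ> leaf_param)) \<subseteq> hull_map \<alpha> ` solenoid"
    using leaf_param_in_solenoid by (auto simp flip: hull_map_leaf_param)
  ultimately show "Omega (\<alpha> \<circ> leaf_param) \<subseteq> hull_map \<alpha> ` solenoid"
    unfolding Omega_def by (intro closure_of_minimal)
  show "hull_map \<alpha> ` solenoid \<subseteq> Omega (\<alpha> \<circ> leaf_param)"
  proof clarify
    fix x assume "x \<in> solenoid"
    then obtain t :: "nat \<Rightarrow> real" where
      "limitin compact_open (\<lambda>n. translate (\<alpha> \<circ> leaf_param) (t n)) (hull_map \<alpha> x) sequentially"
      by (rule hull_map_limit_of_translates)
    then show "hull_map \<alpha> x \<in> Omega (\<alpha> \<circ> leaf_param)"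
      unfolding Omega_def
    proof (rule limitin_closedin)
      have "translate (\<alpha> \<circ> leaf_param) u \<in> topspace compact_open" for u
        unfolding topspace_compact_open hull_map_leaf_param[symmetric]
        using continuous_hull_map[OF leaf_param_in_solenoid] by blast
      then have "range (translate (\<alpha> \<circ> leaf_param)) \<subseteq> compact_open closure_of range (translate (\<alpha> \<circ> leaf_param))"
        by (intro closure_of_subset) blast
      then show "\<forall>\<^sub>F n in sequentially. translate (\<alpha> \<circ> leaf_param) (t n)
          \<in> compact_open closure_of range (translate (\<alpha> \<circ> leaf_param))"
        by (intro always_eventually) blast
    qed simp_all
  qed
qed

section \<open>The group law on the hull\<close>

lemma limitin_translate_add:
  assumes "a \<in> solenoid" "b \<in> solenoid"
    and "limitin compact_open (\<lambda>n. translate (\<alpha> \<circ> leaf_param) (t n)) (hull_map \<alpha> a) F"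
    and "limitin compact_open (\<lambda>n. translate (\<alpha> \<circ> leaf_param) (s n)) (hull_map \<alpha> b) F"
  shows "limitin compact_open (\<lambda>n. translate (\<alpha> \<circ> leaf_param) (t n + s n)) (hull_map \<alpha> (a \<cdot> b)) F"
  using limitin_hull_map_mult[OF leaf_param_in_solenoid leaf_param_in_solenoid assms(1,2), of t F s] assms(3,4)
  unfolding leaf_param_add[symmetric] hull_map_leaf_param by blast

lemma Omega_mult_hull_map:
  assumes a: "a \<in> solenoid" and b: "b \<in> solenoid"
  shows "Omega_mult (\<alpha> \<circ> leaf_param) (hull_map \<alpha> a) (hull_map \<alpha> b) = hull_map \<alpha> (a \<cdot> b)"
  unfolding Omega_mult_def
proof (rule the_equality)
  show "\<forall>t s. limitin compact_open (\<lambda>n. translate (\<alpha> \<circ> leaf_param) (t n)) (hull_map \<alpha> a) sequentially \<longrightarrow>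
      limitin compact_open (\<lambda>n. translate (\<alpha> \<circ> leaf_param) (s n)) (hull_map \<alpha> b) sequentially \<longrightarrow>
      limitin compact_open (\<lambda>n. translate (\<alpha> \<circ> leaf_param) (t n + s n)) (hull_map \<alpha> (a \<cdot> b)) sequentially"
    by (intro allI impI limitin_translate_add a b)
  fix h
  assume h: "\<forall>t s. limitin compact_open (\<lambda>n. translate (\<alpha> \<circ> leaf_param) (t n)) (hull_map \<alpha> a) sequentially \<longrightarrow>
      limitin compact_open (\<lambda>n. translate (\<alpha> \<circ> leaf_param) (s n)) (hull_map \<alpha> b) sequentially \<longrightarrow>
      limitin compact_open (\<lambda>n. translate (\<alpha> \<circ> leaf_param) (t n + s n)) h sequentially"
  \<comment> \<open>At least one pair of representing sequences must exist, or the condition on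
    \<open>h\<close> would be vacuous and the description not unique. Uniqueness of limits then
    identifies \<open>h\<close>.\<close>
  obtain t s :: "nat \<Rightarrow> real" where
    ts: "limitin compact_open (\<lambda>n. translate (\<alpha> \<circ> leaf_param) (t n)) (hull_map \<alpha> a) sequentially"
      "limitin compact_open (\<lambda>n. translate (\<alpha> \<circ> leaf_param) (s n)) (hull_map \<alpha> b) sequentially"
    using hull_map_limit_of_translates a b by metis
  show "h = hull_map \<alpha> (a \<cdot> b)"
    by (rule limitin_Hausdorff_unique[OF _ limitin_translate_add[OF a b ts] _ Hausdorff_space_compact_open])
      (use h ts in simp_all)
qed

lemma topspace_Omega_topology: "topspace (Omega_topology (\<alpha> \<circ> leaf_param)) = hull_map \<alpha> ` solenoid"
  unfolding Omega_topology_def Omega_eq_hull topspace_subtopology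
  using continuous_map_image_subset_topspace[OF continuous_map_hull_map] by auto

text \<open>The group axioms for the hull are transported: it is the image of a group under a
  multiplicative map.\<close>

lemma group_hom_hull_map: "group_hom solenoid_group (Omega_group (\<alpha> \<circ> leaf_param)) (hull_map \<alpha>)"
proof -
  let ?H = "Omega_group (\<alpha> \<circ> leaf_param)"
  have hom: "hull_map \<alpha> \<in> hom solenoid_group ?H"
    unfolding hom_def by (auto simp: Omega_group_def Omega_eq_hull Omega_mult_hull_map)
  \<comment> \<open>The translate by 0 is the image of the identity, so the prescribed neutral
    element is the one carried by the image.\<close>
  have "translate (\<alpha> \<circ> leaf_param) 0 = \<alpha> \<circ> leaf_param" by (simp add: translate_def comp_def)
  then have "?H\<lparr>carrier := hull_map \<alpha> ` carrier solenoid_group, one := hull_map \<alpha> \<one>\<^bsub>solenoid_group\<^esub>\<rparr> = ?H"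
    by (simp add: one_solenoid_group hull_map_leaf_param Omega_group_def Omega_eq_hull)
  then have "Group.group ?H"
    using solenoid.hom_imp_img_group[OF hom] by simp
  then show ?thesis
    using hom by (simp add: group_hom_def group_hom_axioms_def solenoid.is_group)
qed

lemma continuous_map_hull_map_Omega:
  "continuous_map solenoid_topology (Omega_topology (\<alpha> \<circ> leaf_param)) (hull_map \<alpha>)"
  unfolding Omega_topology_def Omega_eq_hull
  by (rule continuous_map_into_subtopology[OF continuous_map_hull_map]) simp

end

section \<open>The extension and the quotient isomorphism\<close>

theorem theorem2p2:
  fixes \<alpha> :: "(nat \<Rightarrow> real set) \<Rightarrow> real"
    and \<alpha>\<^sub>0 :: "real \<Rightarrow> real"
    and K\<^sub>0 :: "(nat \<Rightarrow> real set) \<Rightarrow> real \<Rightarrow> real"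
  assumes "continuous_map solenoid_topology euclideanreal \<alpha>"
    and "\<alpha>\<^sub>0 = \<alpha> \<circ> leaf_param"
    and "\<And>t. K\<^sub>0 (leaf_param t) = translate \<alpha>\<^sub>0 t"
  shows
    "(\<forall>f g t s.
        limitin compact_open (\<lambda>n::nat. translate \<alpha>\<^sub>0 (t n)) f sequentially \<longrightarrow>
        limitin compact_open (\<lambda>n::nat. translate \<alpha>\<^sub>0 (s n)) g sequentially \<longrightarrow>
        limitin compact_open (\<lambda>n::nat. translate \<alpha>\<^sub>0 (t n + s n))
          (f \<otimes>\<^bsub>Omega_group \<alpha>\<^sub>0\<^esub> g) sequentially) \<and>
     (\<exists>K. (\<forall>x\<in>base_leaf. K x = K\<^sub>0 x) \<and>
        continuous_map solenoid_topology (Omega_topology \<alpha>\<^sub>0) K \<and>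
        group_hom solenoid_group (Omega_group \<alpha>\<^sub>0) K \<and>
        K ` carrier solenoid_group = carrier (Omega_group \<alpha>\<^sub>0) \<and>
        (let N = kernel solenoid_group (Omega_group \<alpha>\<^sub>0) K; K' = (\<lambda>X. the_elem (K ` X)) in
           N \<lhd> solenoid_group \<and> closedin solenoid_topology N \<and>
           K' \<in> iso (solenoid_group Mod N) (Omega_group \<alpha>\<^sub>0) \<and>
           homeomorphic_map (quotient_group_topology solenoid_group solenoid_topology N)
             (Omega_topology \<alpha>\<^sub>0) K'))"
proof -
  interpret solenoid_function \<alpha> by unfold_locales fact
  let ?K = "hull_map \<alpha>"
  interpret K: group_hom solenoid_group "Omega_group \<alpha>\<^sub>0" ?K
    unfolding assms(2) by (rule group_hom_hull_map)
  have mult: "f \<otimes>\<^bsub>Omega_group \<alpha>\<^sub>0\<^esub> g = Omega_mult (\<alpha> \<circ> leaf_param) f g" for f g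
    by (simp add: Omega_group_def assms(2))
  have carrier: "carrier (Omega_group \<alpha>\<^sub>0) = ?K ` solenoid"
    by (simp add: Omega_group_def assms(2) Omega_eq_hull)
  \<comment> \<open>The hull is closed, so any limit of translates has a preimage in the solenoid;
    this puts arbitrary \<open>f\<close> and \<open>g\<close> in the form where the product is
    known.\<close>
  have in_image: "f \<in> ?K ` solenoid"
    if "limitin compact_open (\<lambda>n::nat. translate (\<alpha> \<circ> leaf_param) (t n)) f sequentially" for f t
  proof -
    have closed: "closedin compact_open (Omega (\<alpha> \<circ> leaf_param))" by (simp add: Omega_def)
    have "translate (\<alpha> \<circ> leaf_param) u \<in> Omega (\<alpha> \<circ> leaf_param)" for u
      unfolding Omega_eq_hull using leaf_param_in_solenoid by (auto simp flip: hull_map_leaf_param)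
    then have "f \<in> Omega (\<alpha> \<circ> leaf_param)"
      by (intro limitin_closedin[OF that closed] always_eventually) simp_all
    then show ?thesis by (simp add: Omega_eq_hull)
  qed
  have limits: "limitin compact_open (\<lambda>n::nat. translate \<alpha>\<^sub>0 (t n + s n)) (f \<otimes>\<^bsub>Omega_group \<alpha>\<^sub>0\<^esub> g) sequentially"
    if "limitin compact_open (\<lambda>n::nat. translate \<alpha>\<^sub>0 (t n)) f sequentially"
      and "limitin compact_open (\<lambda>n::nat. translate \<alpha>\<^sub>0 (s n)) g sequentially" for f g t s
  proof -
    note lim = that[unfolded assms(2)]
    obtain a b where ab: "a \<in> solenoid" "b \<in> solenoid" "f = ?K a" "g = ?K b"
      using in_image[OF lim(1)] in_image[OF lim(2)] by blast
    show ?thesis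
      unfolding mult ab(3,4) Omega_mult_hull_map[OF ab(1,2)]
      unfolding assms(2)
      by (rule limitin_translate_add[OF ab(1,2) lim[unfolded ab(3,4)]])
  qed
  have leaf: "?K x = K\<^sub>0 x" if "x \<in> base_leaf" for x
    using that by (auto simp: base_leaf_def hull_map_leaf_param assms(3) assms(2))
  have cont: "continuous_map solenoid_topology (Omega_topology \<alpha>\<^sub>0) ?K"
    unfolding assms(2) by (rule continuous_map_hull_map_Omega)
  have surj: "?K ` carrier solenoid_group = carrier (Omega_group \<alpha>\<^sub>0)"
    by (simp add: carrier)
  have Hausdorff: "Hausdorff_space (Omega_topology \<alpha>\<^sub>0)"
    unfolding Omega_topology_def by (rule Hausdorff_space_subtopology[OF Hausdorff_space_compact_open])
  have topspace: "topspace (Omega_topology \<alpha>\<^sub>0) = ?K ` carrier solenoid_group"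
    unfolding assms(2) by (simp add: topspace_Omega_topology)
  let ?N = "kernel solenoid_group (Omega_group \<alpha>\<^sub>0) ?K"
  \<comment> \<open>The kernel is the preimage of a point, which is closed in a Hausdorff
    space.\<close>
  have closed: "closedin solenoid_topology ?N"
  proof -
    have "\<one>\<^bsub>Omega_group \<alpha>\<^sub>0\<^esub> \<in> topspace (Omega_topology \<alpha>\<^sub>0)"
      unfolding topspace surj by (rule K.H.one_closed)
    then have "closedin (Omega_topology \<alpha>\<^sub>0) {\<one>\<^bsub>Omega_group \<alpha>\<^sub>0\<^esub>}"
      by (rule closedin_Hausdorff_singleton[OF Hausdorff])
    from closedin_continuous_map_preimage[OF cont this] show ?thesis
      by (simp add: kernel_def)
  qed
  have "homeomorphic_map (quotient_group_topology solenoid_group solenoid_topology ?N)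
      (Omega_topology \<alpha>\<^sub>0) (\<lambda>X. the_elem (?K ` X))"
    by (rule homeomorphic_map_coset_quotient[OF K.group_hom_axioms _ compact_space_solenoid_topology
          Hausdorff topspace cont]) simp
  then show ?thesis
    unfolding Let_def
    using limits leaf cont K.group_hom_axioms surj K.normal_kernel closed K.FactGroup_iso_set[OF surj]
    by (intro conjI exI[of _ ?K] allI impI ballI)
qed

end
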